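(* For every positive integer $n>4$ there is a prime number $p$ with $8n<p<9n$. *)

theory Defs
  imports Complex_Main "HOL-Computational_Algebra.Primes"
begin

end

theory Submission
  imports Defs "HOL-Number_Theory.Prime_Powers" "HOL-Analysis.Harmonic_Numbers"
    "HOL-Library.Code_Binary_Nat"
begin

text \<open>
  A refinement of Chebyshev's method. For a finite combination of the functions
  \<open>ln (fact (x div k))\<close>, Stirling's formula gives the asymptotics, while the identity
  \<open>ln (fact N) = (\<Sum>m\<le>N. mangoldt m * (N div m))\<close> turns it into
  \<open>\<Sum>m. mangoldt m * weight (72 * n div m)\<close> for a step function \<open>weight\<close>. The combination is
  chosen such that \<open>weight 8 = 2\<close>, which corresponds to \<open>8 * n < m \<le> 9 * n\<close>, such that
  \<open>weight t \<le> 0\<close> for all other \<open>t < 4000\<close>, and such that \<open>weight\<close> is bounded by 18. The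
  contribution of \<open>t \<ge> 4000\<close> is controlled by the elementary bound \<open>psi z \<le> z * ln 4\<close>, and the
  Stirling main term exceeds it by a positive multiple of \<open>n\<close>. The proper prime powers
  in \<open>{8*n<..9*n}\<close> contribute only \<open>O(sqrt n * ln n)\<close>. Small \<open>n\<close> are covered by a chain of
  explicit primes.
\<close>

section \<open>Log factorials, the von Mangoldt function and Chebyshev's bound on
  \<open>psi\<close>\<close>

text \<open>Passing from \<open>k\<close> to \<open>Suc k\<close> raises \<open>k div m\<close> by
  one exactly when \<open>m\<close> divides \<open>Suc k\<close>, and \<open>mangoldt\<close> summed
  over these divisors is \<open>ln (Suc k)\<close>. The free bound \<open>N\<close> lets several
  factorials share one index range.\<close>

lemma ln_fact_eq_sum_mangoldt:
  assumes "k \<le> N"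
  shows "ln (fact k) = (\<Sum>m=1..N. mangoldt m * real (k div m))"
  using assms
proof (induction k)
  case (Suc k)
  have "(\<Sum>m=1..N. mangoldt m * real (Suc k div m)) =
        (\<Sum>m=1..N. mangoldt m * real (k div m) + (if m dvd Suc k then mangoldt m else 0))"
    by (intro sum.cong) (auto simp: div_Suc dvd_eq_mod_eq_0 algebra_simps)
  also have "\<dots> = ln (fact k) + (\<Sum>m=1..N. if m dvd Suc k then mangoldt m else 0)"
    using Suc by (simp add: sum.distrib)
  also have "(\<Sum>m=1..N. if m dvd Suc k then mangoldt m else 0) = (\<Sum>m | m dvd Suc k. mangoldt m :: real)"
  proof -
    have "{m \<in> {1..N}. m dvd Suc k} = {m. m dvd Suc k}"
      using Suc.prems by (auto dest: dvd_imp_le intro!: Nat.gr0I Suc_leI)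
    thus ?thesis by (simp add: sum.inter_filter flip: sum.inter_filter)
  qed
  also have "\<dots> = ln (real (Suc k))"
    by (subst mangoldt_sum) simp_all
  also have "ln (fact k) + ln (real (Suc k)) = ln (fact (Suc k))"
    by (simp add: ln_mult del: of_nat_Suc)
  finally show ?case ..
qed simp

definition psi :: "nat \<Rightarrow> real" where
  "psi n = (\<Sum>m=1..n. mangoldt m)"

text \<open>Halve \<open>n = a + b\<close>: every \<open>mangoldt m\<close> with
  \<open>b < m \<le> a + b\<close> is contained in the logarithm of \<open>(a + b) choose a\<close>,
  which is at most \<open>4 ^ a\<close>; the induction hypothesis handles \<open>b\<close>.\<close>

lemma psi_le: "psi n \<le> real n * ln 4"
proof (induction n rule: less_induct)
  case (less n)
  have bin: "psi (a + b) - psi b \<le> ln (real ((a + b) choose a))" if "a \<le> b" "b \<le> Suc a" for a b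
  proof -
    have "fact a * fact b * ((a + b) choose a) = (fact (a + b) :: nat)"
      using binomial_fact_lemma[of a "a + b"] by simp
    hence "fact (a + b) = fact a * fact b * real ((a + b) choose a)"
      by (metis of_nat_fact of_nat_mult)
    hence "ln (real ((a + b) choose a)) = ln (fact (a + b)) - ln (fact a) - ln (fact b)"
      by (simp add: ln_mult)
    also have "\<dots> = (\<Sum>m=1..a+b. mangoldt m *
        (real ((a + b) div m) - real (a div m) - real (b div m)))"
      by (simp add: ln_fact_eq_sum_mangoldt[of _ "a+b"] algebra_simps sum.distrib sum_subtractf)
    also have "\<dots> \<ge> (\<Sum>m=1..a+b. if b < m then mangoldt m else 0)"
    proof (intro sum_mono)
      fix m assume m: "m \<in> {1..a+b}"
      show "(if b < m then mangoldt m else 0) \<le> (mangoldt m :: real) *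
          (real ((a + b) div m) - real (a div m) - real (b div m))"
      proof (cases "b < m")
        case True
        have "(a + b) div m \<ge> 1" using m by (simp add: Suc_le_eq div_greater_zero_iff)
        thus ?thesis using True that by (simp add: mult_le_cancel_left1 mangoldt_nonneg leD)
      next
        case False
        have "a div m + b div m \<le> (a + b) div m" by (subst div_add1_eq) simp
        hence "real ((a + b) div m) - real (a div m) - real (b div m) \<ge> 0" by linarith
        thus ?thesis using False by (simp add: mangoldt_nonneg)
      qed
    qed
    also have "(\<Sum>m=1..a+b. if b < m then mangoldt m else 0) = (\<Sum>m\<in>{1..a+b}-{1..b}. mangoldt m :: real)"
      by (subst sum.inter_filter [symmetric]) (auto intro!: sum.cong)
    also have "\<dots> = psi (a + b) - psi b"
      unfolding psi_def by (subst sum_diff) auto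
    finally show ?thesis .
  qed
  show ?case
  proof (cases "n \<le> 1")
    case True
    thus ?thesis by (cases n) (auto simp: psi_def)
  next
    case False
    define a b where "a = n div 2" and "b = n - a"
    have ab: "a \<le> b" "b \<le> Suc a" "n = a + b" "b < n" using False by (auto simp: a_def b_def)
    have "real ((a + b) choose a) \<le> 4 ^ a"
    proof -
      have "b = a \<or> b = Suc a" using ab by auto
      thus ?thesis
      proof
        assume "b = a"
        have "(2 * a) choose a \<le> 2 ^ (2 * a)" by (rule binomial_le_pow2)
        also have "2 ^ (2 * a) = (4::nat) ^ a" by (simp add: power_mult)
        finally show ?thesis unfolding \<open>b = a\<close> mult_2 by (simp flip: of_nat_power)
      next
        assume b: "b = Suc a"
        \<comment> \<open>The two central coefficients agree, so each is at most half of the row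
          sum; the bound by the whole row would lose a factor 2.\<close>
        have "2 * ((2 * a + 1) choose a) = ((2 * a + 1) choose a) + ((2 * a + 1) choose (Suc a))"
          using binomial_symmetric[of a "2 * a + 1"] by simp
        also have "\<dots> = sum ((choose) (2 * a + 1)) {a, Suc a}" by simp
        also have "\<dots> \<le> sum ((choose) (2 * a + 1)) {..2 * a + 1}"
          by (intro sum_mono2) auto
        also have "\<dots> = 2 * 4 ^ a" by (subst choose_row_sum) (simp add: power_mult)
        finally have "(2 * a + 1) choose a \<le> 4 ^ a" by simp
        moreover have "a + b = 2 * a + 1" by (simp add: b)
        ultimately show ?thesis by (metis of_nat_le_iff of_nat_numeral of_nat_power)
      qed
    qed
    hence "ln (real ((a + b) choose a)) \<le> ln (4 ^ a)"
      by (subst ln_le_cancel_iff) (auto simp: zero_less_binomial_iff)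
    hence "psi n \<le> real a * ln 4 + psi b"
      using bin[OF ab(1,2)] by (simp add: ab(3) ln_realpow)
    also have "psi b \<le> real b * ln 4" by (rule less.IH) fact
    finally show ?thesis by (simp add: ab(3) algebra_simps)
  qed
qed

section \<open>Stirling bounds for factorials of integer quotients\<close>

lemma divide_le_nat_div_plus_1:
  fixes x k :: nat
  assumes "0 < k"
  shows "real x / real k \<le> real (x div k) + 1"
proof -
  have "x \<le> k * (x div k + 1)"
    using dividend_less_times_div[OF assms, of x] by simp
  hence "real x \<le> real k * (real (x div k) + 1)"
    by (metis of_nat_1 of_nat_add of_nat_le_iff of_nat_mult)
  thus ?thesis using assms by (simp add: field_simps)
qed

text \<open>Elementary Stirling bounds at \<open>N = x div k\<close> are moved to \<open>y\<close>,
  which lies in \<open>[N, N + 1]\<close>. As \<open>u * ln u - u\<close> has derivative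
  \<open>ln u\<close>, this costs at most \<open>ln y\<close>.\<close>

lemma ln_fact_floor_bounds:
  fixes x k :: nat
  assumes "0 < k" "k \<le> x"
  defines "y \<equiv> real x / real k"
  shows "\<bar>ln (fact (x div k)) - (y * ln y - y + 1)\<bar> \<le> ln x"
proof -
  define N where "N = x div k"
  have N: "N \<ge> 1" using assms by (simp add: N_def Suc_le_eq div_greater_zero_iff)
  have mono: "u * ln u - u \<le> v * ln v - v" if "1 \<le> u" "u \<le> v" for u v :: real
  proof -
    have "ln (v / u) \<ge> 1 - u / v"
      using ln_le_minus_one[of "u / v"] that by (simp add: ln_div)
    hence "v * ln v - v * ln u \<ge> v - u" using that by (simp add: ln_div field_simps)
    moreover have "(v - u) * ln u \<ge> 0" using that by simp
    ultimately show ?thesis by (simp add: algebra_simps)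
  qed
  have stirling: "n * ln n - n + 1 \<le> ln (fact n) \<and> ln (fact n) \<le> n * ln n - n + 1 + ln n"
    if "n \<ge> 1" for n :: nat
    using that
  proof (induction n rule: nat_induct_at_least)
    case (Suc n)
    have d: "ln (real (Suc n)) - ln (real n) \<le> 1 / n" "ln (real (Suc n)) - ln (real n) \<ge> 1 / Suc n"
      using ln_le_minus_one[of "Suc n / n"] ln_le_minus_one[of "n / Suc n"] Suc.hyps
      by (auto simp: ln_div field_simps)
    have f: "ln (fact (Suc n)) = ln (real (Suc n)) + ln (fact n)"
      by (simp add: ln_mult del: of_nat_Suc)
    have "real n * (ln (real (Suc n)) - ln (real n)) \<le> 1"
         "real (Suc n) * (ln (real (Suc n)) - ln (real n)) \<ge> 1"
      using d Suc.hyps by (simp_all add: field_simps)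
    with Suc.IH show ?case unfolding f by (simp add: algebra_simps)
  qed simp
  have y: "real N \<le> y" "y \<le> real N + 1" "y \<le> real x" "y \<ge> 1"
  proof -
    show "real N \<le> y" unfolding N_def y_def by (rule of_nat_div_le_of_nat)
    show "y \<le> real N + 1" unfolding N_def y_def by (rule divide_le_nat_div_plus_1) fact
    show "y \<le> real x" "y \<ge> 1" using assms by (simp_all add: y_def field_simps)
  qed
  have "ln (fact N) \<le> N * ln N - N + 1 + ln N" using stirling[OF N] by simp
  also have "\<dots> \<le> y * ln y - y + 1 + ln x"
  proof -
    have "ln (real N) \<le> ln x" using y N by (subst ln_le_cancel_iff) auto
    thus ?thesis using mono[of N y] y N by linarith
  qed
  finally have 1: "ln (fact N) \<le> y * ln y - y + 1 + ln x" .
  have "y * ln y - y \<le> (N * ln N - N) + ln y"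
  proof -
    have "ln (y / N) \<le> y / N - 1" using y N by (intro ln_le_minus_one) simp
    hence "N * ln y - N * ln N \<le> y - N" using y N by (simp add: ln_div field_simps)
    moreover have "(y - N - 1) * ln y \<le> 0" using y by (intro mult_nonpos_nonneg) simp_all
    ultimately show ?thesis by (simp add: algebra_simps)
  qed
  also have "ln y \<le> ln x" using y by simp
  finally have 2: "y * ln y - y + 1 - ln x \<le> ln (fact N)" using stirling[OF N] by simp
  show ?thesis using 1 2 unfolding N_def by linarith
qed

section \<open>Combinations of log factorials and their weights\<close>

definition floor_comb :: "(nat \<times> int) list \<Rightarrow> nat \<Rightarrow> int" where
  "floor_comb cs u = (\<Sum>(k, c)\<leftarrow>cs. c * int (u div k))"

definition ln_fact_comb :: "(nat \<times> int) list \<Rightarrow> nat \<Rightarrow> real" where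
  "ln_fact_comb cs x = (\<Sum>(k, c)\<leftarrow>cs. of_int c * ln (fact (x div k)))"

text \<open>
  The weights are half-integers, stored doubled. They were obtained by rounding a solution of the
  linear programme that maximises the resulting lower bound subject to the sign conditions of the
  lemma \<open>weight_le_0\<close>. The pair \<open>(168, -1)\<close> ensures that the sum of \<open>c / k\<close> over \<open>weights_b\<close>
  vanishes; for \<open>weights_a\<close> no such condition is needed, as \<open>1 / 8 = 1 / 9 + 1 / 72\<close>.
\<close>

definition weights_a :: "(nat \<times> int) list" where
  "weights_a = [(1,2),(2,-2),(3,-2),(5,-2),(6,2),(7,-2),(9,1),(10,2),(11,-1),(13,-1),(14,2),(17,-1),
    (18,-2),(19,-1),(21,1),(22,1),(23,-1),(26,1),(29,-2),(31,-1),(38,1),(41,-1),(42,-1),(43,-1)]"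

definition weights_b :: "(nat \<times> int) list" where
  "weights_b = [(1,1),(2,-1),(3,-1),(4,-1),(7,-1),(12,1),(14,1),(24,1),(28,1),(168,-1)]"

text \<open>At \<open>t = 72 * n div m\<close> the arguments are \<open>9 * n div m\<close>,
  \<open>8 * n div m\<close> and \<open>n div m\<close>, since 72 is the least common multiple of 8
  and 9.\<close>

definition weight :: "nat \<Rightarrow> int" where
  "weight t = floor_comb weights_a (t div 8) - floor_comb weights_a (t div 9)
     - floor_comb weights_a (t div 72) + floor_comb weights_b (t div 72)"

lemma ln_fact_comb_eq_sum_mangoldt:
  assumes "x \<le> N"
  shows "ln_fact_comb cs x = (\<Sum>m=1..N. mangoldt m * of_int (floor_comb cs (x div m)))"
proof (induction cs)
  case (Cons kc cs)
  obtain k c where kc: "kc = (k, c)" by (cases kc)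
  have "ln (fact (x div k)) = (\<Sum>m=1..N. mangoldt m * real (x div k div m))"
    by (rule ln_fact_eq_sum_mangoldt) (meson assms div_le_dividend order_trans)
  moreover have "x div k div m = x div m div k" for m
    by (metis div_mult2_eq mult.commute)
  ultimately show ?case
    using Cons by (simp add: kc ln_fact_comb_def floor_comb_def sum_distrib_left algebra_simps sum.distrib)
qed (simp_all add: ln_fact_comb_def floor_comb_def)

text \<open>Stirling is applied to each term, with \<open>ln (x / k)\<close> split as
  \<open>ln x - ln k\<close>.\<close>

lemma ln_fact_comb_approx:
  assumes "\<forall>(k, c)\<in>set cs. 0 < k \<and> k \<le> x" "x > 0"
  shows "\<bar>ln_fact_comb cs x - ((x * ln x - x) * (\<Sum>(k, c)\<leftarrow>cs. of_int c / real k)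
            - x * (\<Sum>(k, c)\<leftarrow>cs. of_int c * ln k / real k) + of_int (\<Sum>(k, c)\<leftarrow>cs. c))\<bar>
          \<le> of_int (\<Sum>(k, c)\<leftarrow>cs. \<bar>c\<bar>) * ln x"
  using assms(1)
proof (induction cs)
  case (Cons kc cs)
  obtain k c where kc: "kc = (k, c)" by (cases kc)
  have k: "0 < k" "k \<le> x" using Cons.prems by (auto simp: kc)
  define y where "y = real x / real k"
  define E where "E = ln (fact (x div k)) - (y * ln y - y + 1)"
  have "\<bar>of_int c * E\<bar> \<le> of_int \<bar>c\<bar> * ln x"
    using ln_fact_floor_bounds[OF k] by (simp add: E_def y_def abs_mult mult_left_mono)
  moreover have "of_int c * ln (fact (x div k)) = of_int c * E +
      ((x * ln x - x) * (of_int c / real k) - x * (of_int c * ln k / real k) + of_int c)"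
    using k assms(2) by (simp add: E_def y_def ln_div field_simps)
  ultimately show ?case
    using Cons by (simp add: kc ln_fact_comb_def algebra_simps)
qed (simp add: ln_fact_comb_def)

text \<open>Rounding \<open>u / k\<close> down loses at most 1, and only a negative coefficient
  turns that loss into a gain.\<close>

lemma floor_comb_le:
  assumes "\<forall>(k, c)\<in>set cs. 0 < k"
  shows "of_int (floor_comb cs u) \<le> u * (\<Sum>(k, c)\<leftarrow>cs. of_int c / real k) + of_int (\<Sum>(k, c)\<leftarrow>cs. max 0 (-c))"
  using assms
proof (induction cs)
  case (Cons kc cs)
  obtain k c where kc: "kc = (k, c)" by (cases kc)
  have k: "0 < k" using Cons.prems by (auto simp: kc)
  define f where "f = u / k - real (u div k)"
  have f: "0 \<le> f" "f \<le> 1"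
    using of_nat_div_le_of_nat[of u k, where ?'a = real] divide_le_nat_div_plus_1[OF k, of u]
    by (simp_all add: f_def)
  have "of_int c * real (u div k) = of_int c * (u / k) - of_int c * f"
    by (simp add: f_def algebra_simps)
  also have "\<dots> \<le> u * (of_int c / k) + of_int (max 0 (-c))"
  proof (cases "c \<ge> 0")
    case True
    hence "of_int c * f \<ge> 0" using f by simp
    thus ?thesis using True by (simp add: mult.commute)
  next
    case False
    hence "(- of_int c) * f \<le> (- of_int c :: real) * 1" using f by (intro mult_left_mono) auto
    thus ?thesis using False by (simp add: mult.commute)
  qed
  finally show ?case using Cons by (simp add: kc floor_comb_def algebra_simps)
qed (simp add: floor_comb_def)

section \<open>Size and sign of the weight\<close>

lemma div_8_9_72_cases:
  fixes u :: nat
  shows "int (u div 8) - int (u div 9) - int (u div 72) \<in> {0, 1}"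
proof -
  define v where "v = u div 9"
  have "u div 72 = v div 8" by (simp add: v_def flip: div_mult2_eq)
  moreover have "u div 8 \<ge> v + v div 8" "u div 8 \<le> v + v div 8 + 1"
    using v_def by linarith+
  ultimately show ?thesis unfolding v_def by auto
qed

text \<open>Integer divisions commute, so each coefficient is multiplied by 0 or 1, and at worst
  exactly the positive ones survive.\<close>

lemma floor_comb_diff_le:
  "floor_comb cs (t div 8) - floor_comb cs (t div 9) - floor_comb cs (t div 72)
     \<le> (\<Sum>(k, c)\<leftarrow>cs. max 0 c)"
proof (induction cs)
  case (Cons kc cs)
  obtain k c where kc: "kc = (k, c)" by (cases kc)
  define h where "h = int (t div 8 div k) - int (t div 9 div k) - int (t div 72 div k)"
  have "t div j div k = t div k div j" for j by (metis div_mult2_eq mult.commute)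
  hence "h \<in> {0, 1}" using div_8_9_72_cases[of "t div k"] by (simp add: h_def)
  hence "c * h \<le> max 0 c" by auto
  thus ?case using Cons by (simp add: kc floor_comb_def h_def algebra_simps)
qed (simp add: floor_comb_def)

text \<open>The 13 is the sum of the positive coefficients of \<open>weights_a\<close>; the 5 is the
  absolute sum of the negative ones of \<open>weights_b\<close>, whose linear term vanishes.\<close>

lemma weight_le_18: "weight t \<le> 18"
proof -
  have "of_int (floor_comb weights_b (t div 72)) \<le> (5::real)"
    using floor_comb_le[of weights_b "t div 72"] by (simp add: weights_b_def)
  moreover have "floor_comb weights_a (t div 8) - floor_comb weights_a (t div 9) - floor_comb weights_a (t div 72) \<le> 13"
    using floor_comb_diff_le[of weights_a t] by (simp add: weights_a_def)
  ultimately show ?thesis by (simp add: weight_def)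
qed

lemma weight_check:
  "list_all (\<lambda>t. t = 8 \<or> weight t \<le> 0) [0..<72]"
  by code_simp

text \<open>
  On a block \<open>t div 72 = w\<close>, only the pairs \<open>(9 * w + r, 8 * w + r)\<close> and \<open>(9 * w + r + 1, 8 * w + r)\<close>
  with \<open>r < 8\<close> occur as \<open>(t div 8, t div 9)\<close>.
\<close>

lemma weight_check_blocks:
  "list_all (\<lambda>w.
     let us = map (floor_comb weights_a) [9 * w..<9 * w + 9];
         vs = map (floor_comb weights_a) [8 * w..<8 * w + 8];
         d = floor_comb weights_b w - floor_comb weights_a w
     in list_all (\<lambda>(v, u, u'). u - v + d \<le> 0 \<and> u' - v + d \<le> 0) (zip vs (zip us (tl us)))) [1..<56]"
  by code_simp

lemma weight_le_0:
  assumes "t < 4000" "t \<noteq> 8"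
  shows "weight t \<le> 0"
proof (cases "t < 72")
  case True
  thus ?thesis using weight_check assms by (auto simp: list_all_iff)
next
  case False
  define w s r where "w = t div 72" and "s = t mod 72" and "r = s div 9"
  have s: "s < 72" "t = 72 * w + s" by (simp_all add: w_def s_def)
  \<comment> \<open>The checked blocks reach \<open>56 * 72 = 4032\<close>, beyond 4000.\<close>
  have w: "w \<in> set [1..<56]" using assms False by (auto simp: w_def)
  have r: "r < 8" using s(1) by (simp add: r_def less_mult_imp_div_less)
  have "t = 9 * (8 * w) + s" using s(2) by simp
  hence t9: "t div 9 = 8 * w + r" unfolding r_def by (simp only: div_mult_self4)
  have "t = 8 * (9 * w) + s" using s(2) by simp
  hence "t div 8 = 9 * w + s div 8" by (simp only: div_mult_self4)
  moreover have "s div 8 = r \<or> s div 8 = Suc r" using r unfolding r_def by linarith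
  ultimately have t8: "t div 8 = 9 * w + r \<or> t div 8 = 9 * w + Suc r" by auto
  define us where "us = map (floor_comb weights_a) [9 * w..<9 * w + 9]"
  define vs where "vs = map (floor_comb weights_a) [8 * w..<8 * w + 8]"
  have "(floor_comb weights_a (8 * w + r), floor_comb weights_a (9 * w + r), floor_comb weights_a (9 * w + Suc r))
           = zip vs (zip us (tl us)) ! r"
    using r by (simp add: us_def vs_def nth_tl del: upt_Suc)
  also have "\<dots> \<in> set (zip vs (zip us (tl us)))"
    using r by (intro nth_mem) (simp add: us_def vs_def)
  finally have mem: "(floor_comb weights_a (8 * w + r), floor_comb weights_a (9 * w + r),
    floor_comb weights_a (9 * w + Suc r)) \<in> set (zip vs (zip us (tl us)))" .
  have "floor_comb weights_a (9 * w + r) - floor_comb weights_a (8 * w + r)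
            + (floor_comb weights_b w - floor_comb weights_a w) \<le> 0 \<and>
        floor_comb weights_a (9 * w + Suc r) - floor_comb weights_a (8 * w + r)
            + (floor_comb weights_b w - floor_comb weights_a w) \<le> 0"
    using weight_check_blocks[unfolded Let_def list_all_iff, THEN bspec, OF w, folded us_def vs_def,
        THEN bspec, OF mem] by simp
  thus ?thesis using t8 t9 by (auto simp: weight_def simp flip: w_def)
qed

section \<open>Trial division and the chain of primes for small arguments\<close>

function no_divisor_from :: "nat \<Rightarrow> nat \<Rightarrow> bool" where
  "no_divisor_from d p =
     (if p < d * d then True else if p mod d = 0 then False else no_divisor_from (d + 2) p)"
  by auto
termination
proof (relation "measure (\<lambda>(d, p). Suc p - d)")
  fix d p :: nat
  assume "\<not> p < d * d" "p mod d \<noteq> 0"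
  hence "d \<le> p" using le_square[of d] by linarith
  thus "((d + 2, p), d, p) \<in> measure (\<lambda>(d, p). Suc p - d)" by simp
qed simp

declare no_divisor_from.simps [simp del]

lemma no_divisor_from_imp_not_dvd:
  assumes "no_divisor_from d p" "odd d" "odd q" "d \<le> q" "q * q \<le> p"
  shows "\<not> q dvd p"
  using assms
proof (induction d p rule: no_divisor_from.induct)
  case (1 d p)
  have "d * d \<le> q * q" using 1(5) by (intro mult_mono) auto
  hence "p mod d \<noteq> 0" "no_divisor_from (d + 2) p"
    using 1(2,6) no_divisor_from.simps[of d p] by (auto split: if_splits)
  show ?case
  proof (cases "q = d")
    case True
    thus ?thesis using \<open>p mod d \<noteq> 0\<close> by (simp add: dvd_eq_mod_eq_0)
  next
    case False
    hence "d + 2 \<le> q" using 1(3-5) by (auto elim!: oddE)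
    thus ?thesis using 1 \<open>d * d \<le> q * q\<close> \<open>p mod d \<noteq> 0\<close> \<open>no_divisor_from (d + 2) p\<close> by auto
  qed
qed

text \<open>The smaller factor in a nontrivial factorisation of an odd number is odd, at least 3,
  and has square at most \<open>p\<close>.\<close>

lemma prime_if_no_divisor_from_3:
  assumes "no_divisor_from 3 p" "odd p" "p > 1"
  shows "prime p"
proof (rule ccontr)
  assume "\<not> prime p"
  then obtain q where q: "q dvd p" "q \<noteq> 1" "q \<noteq> p"
    using assms(3) by (auto simp: prime_nat_iff)
  then obtain r where r: "p = q * r" by blast
  hence qr: "p = q * r" "q \<noteq> 1" "r \<noteq> 1" using q by auto
  define d where "d = min q r"
  have "d dvd p" "odd d" using qr assms(2) by (auto simp: d_def min_def)
  moreover have "d * d \<le> p" unfolding qr(1) d_def by (intro mult_mono) auto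
  moreover have "d \<ge> 3"
  proof -
    have "d \<noteq> 1" using qr by (auto simp: d_def min_def)
    thus ?thesis using \<open>odd d\<close> by presburger
  qed
  ultimately show False using no_divisor_from_imp_not_dvd[OF assms(1)] by auto
qed

text \<open>The prime \<open>q\<close> serves every \<open>n \<ge> m\<close> with
  \<open>8 * n < q\<close>. The first \<open>n\<close> it misses is \<open>q / 8\<close> rounded up,
  which is \<open>(q + 7) div 8\<close>; the chain resumes there.\<close>

fun prime_chain :: "nat \<Rightarrow> nat list \<Rightarrow> nat \<Rightarrow> bool" where
  "prime_chain m [] e \<longleftrightarrow> e \<le> m"
| "prime_chain m (q # qs) e \<longleftrightarrow>
     1 < q \<and> odd q \<and> q < 9 * m \<and> no_divisor_from 3 q \<and> prime_chain ((q + 7) div 8) qs e"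

lemma prime_chain_imp:
  assumes "prime_chain m qs e" "m \<le> n" "n < e"
  shows "\<exists>p. prime p \<and> 8 * n < p \<and> p < 9 * n"
  using assms
proof (induction qs arbitrary: m)
  case (Cons q qs)
  show ?case
  proof (cases "(q + 7) div 8 \<le> n")
    case True
    thus ?thesis using Cons by auto
  next
    case False
    hence "8 * n < q" by linarith
    moreover have "q < 9 * n" "prime q"
      using Cons.prems by (auto intro: prime_if_no_divisor_from_3)
    ultimately show ?thesis by blast
  qed
qed auto

lemma prime_chain_100000:
  "prime_chain 5 [43, 53, 61, 71, 79, 89, 107, 113, 131, 151, 167, 181, 199, 223, 251, 283, 317,
     359, 401, 457, 521, 593, 673, 761, 863, 971, 1097, 1237, 1381, 1553, 1753, 1979, 2221, 2477,
     2789, 3137, 3533, 3967, 4463, 5021, 5651, 6361, 7159, 8053, 9059, 10193, 11471, 12899, 14503,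
     16301, 18341, 20627, 23209, 26113, 29383, 33053, 37181, 41813, 47041, 52919, 59513, 66959,
     75329, 84751, 95339, 107251, 120661, 135743, 152681, 171763, 193201, 217351, 244507, 275059,
     309437, 348097, 391613, 440567, 495637, 557591, 627271, 705643, 793853, 893059] 100000"
  by code_simp

section \<open>Lower and upper estimates of the weighted sum\<close>

text \<open>The logarithms of 3 and 7 are derived from those of \<open>3/2\<close> and
  \<open>8/7\<close>, where few series terms suffice.\<close>

lemma ln_2_3_7_bounds:
  "ln (2::real) \<in> {0.69314..0.69315}" "ln (3::real) \<in> {1.0986..1.09863}" "ln (7::real) \<in> {1.9458..1.94593}"
proof -
  show 2: "ln (2::real) \<in> {0.69314..0.69315}"
    using ln_approx_bounds[of 2 5] by (simp add: eval_nat_numeral) 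
  have "ln (3/2::real) \<in> {0.40546..0.40547}"
    using ln_approx_bounds[of "3/2" 4] by (simp add: eval_nat_numeral) 
  thus "ln (3::real) \<in> {1.0986..1.09863}" using 2 by (simp add: ln_div)
  have "ln (8/7::real) \<in> {0.13353..0.13354}"
    using ln_approx_bounds[of "8/7" 2] by (simp add: eval_nat_numeral) 
  moreover have "ln (8::real) = 3 * ln 2" using ln_realpow[of 2 3] by simp
  ultimately show "ln (7::real) \<in> {1.9458..1.94593}" using 2 by (simp add: ln_div)
qed

text \<open>From \<open>168\<close> on, every \<open>k\<close> in both lists is at most
  \<open>n\<close>, as the Stirling approximation demands. The error constant is
  \<open>112 = 3 * 34 + 10\<close>, from three uses of \<open>weights_a\<close> and one of
  \<open>weights_b\<close>.\<close>

lemma sum_mangoldt_weight_lower: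
  assumes "n \<ge> 168"
  shows "(\<Sum>m=1..72*n. mangoldt m * of_int (weight (72 * n div m))) \<ge> 677 / 1000 * n - 112 * ln (9 * n)"
proof -
  have div: "72 * n div m div 8 = 9 * n div m" "72 * n div m div 9 = 8 * n div m"
     "72 * n div m div 72 = n div m" for m
  proof -
    have "72 * n div m div 8 = 8 * (9 * n) div 8 div m" 
       "72 * n div m div 9 = 9 * (8 * n) div 9 div m" "72 * n div m div 72 = 72 * n div 72 div m"
      by (simp_all flip: div_mult2_eq add: mult.commute)
    thus "72 * n div m div 8 = 9 * n div m" "72 * n div m div 9 = 8 * n div m"
     "72 * n div m div 72 = n div m" by simp_all
  qed
  have sum_eq: "(\<Sum>m=1..72*n. mangoldt m * of_int (weight (72 * n div m))) =
      ln_fact_comb weights_a (9 * n) - ln_fact_comb weights_a (8 * n) - ln_fact_comb weights_a n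
        + ln_fact_comb weights_b n"
    unfolding weight_def div
    by (simp add: ln_fact_comb_eq_sum_mangoldt[of _ "72 * n"] algebra_simps
          flip: sum.distrib sum_subtractf)
  define R :: real where "R = (\<Sum>(k, c)\<leftarrow>weights_a. of_int c / real k)"
  define Q :: real where "Q = (\<Sum>(k, c)\<leftarrow>weights_a. of_int c * ln k / real k)"
  define Q' :: real where "Q' = (\<Sum>(k, c)\<leftarrow>weights_b. of_int c * ln k / real k)"
  have a: "\<bar>ln_fact_comb weights_a x - ((x * ln x - x) * R - x * Q - 8)\<bar> \<le> 34 * ln (9 * n)"
    if "x \<ge> n" "x \<le> 9 * n" for x
  proof -
    have "\<bar>ln_fact_comb weights_a x - ((x * ln x - x) * R - x * Q - 8)\<bar> \<le> 34 * ln x"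
      using ln_fact_comb_approx[of weights_a x] that assms
      unfolding R_def Q_def by (simp add: weights_a_def)
    also have "\<dots> \<le> 34 * ln (9 * n)" using that assms by simp
    finally show ?thesis .
  qed
  have b: "\<bar>ln_fact_comb weights_b n - (- (n * Q'))\<bar> \<le> 10 * ln (9 * n)"
  proof -
    have "\<bar>ln_fact_comb weights_b n - (- (n * Q'))\<bar> \<le> 10 * ln n"
      using ln_fact_comb_approx[of weights_b n] assms
      unfolding Q'_def by (simp add: weights_b_def)
    also have "\<dots> \<le> 10 * ln (9 * n)" using assms by simp
    finally show ?thesis .
  qed
  have ln_mult_n: "ln (9 * real n) = 2 * ln 3 + ln n" "ln (8 * real n) = 3 * ln 2 + ln n"
    using assms ln_realpow[of 3 2] ln_realpow[of 2 3] by (simp_all add: ln_mult)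
  have "n * ((18 * ln 3 - 24 * ln 2) * R - Q') + 8 - 112 * ln (9 * n) \<le>
      (\<Sum>m=1..72*n. mangoldt m * of_int (weight (72 * n div m)))"
  proof -
    \<comment> \<open>Since \<open>9 - 8 - 1 = 0\<close>, the terms in \<open>n * ln n\<close>,
      \<open>n\<close> and \<open>Q\<close> cancel; what remains is
      \<open>9 * ln 9 - 8 * ln 8\<close> times \<open>n * R\<close>, and a constant.\<close>
    have "((9 * n :: nat) * ln (9 * n :: nat) - (9 * n :: nat)) * R - (9 * n :: nat) * Q - 8
        - (((8 * n :: nat) * ln (8 * n :: nat) - (8 * n :: nat)) * R - (8 * n :: nat) * Q - 8)
        - ((n * ln n - n) * R - n * Q - 8) = n * ((18 * ln 3 - 24 * ln 2) * R) + 8"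
      by (simp add: ln_mult_n) (simp add: algebra_simps)
    thus ?thesis
      using a[of "9 * n"] a[of "8 * n"] a[of n] b
      unfolding sum_eq abs_le_iff right_diff_distrib[of "real n"] by linarith
  qed
  moreover have "(18 * ln 3 - 24 * ln 2) * R - Q' \<ge> 677 / 1000"
  proof -
    have "R = - (2436974689274 / 176794072049595)"
      by (simp add: R_def weights_a_def)
    \<comment> \<open>\<open>R\<close> is negative, so its positive factor must be bounded from
      above.\<close>
    hence "(18 * ln 3 - 24 * ln 2) * R \<ge> 3.14 * (-0.013786)"
      using ln_2_3_7_bounds by (simp add: mult_le_cancel_right)
    moreover have "ln (4::real) = 2 * ln 2" "ln (12::real) = 2 * ln 2 + ln 3"
      "ln (14::real) = ln 2 + ln 7" "ln (24::real) = 3 * ln 2 + ln 3"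
      "ln (28::real) = 2 * ln 2 + ln 7" "ln (168::real) = 3 * ln 2 + ln 3 + ln 7"
      using ln_mult[of 2 2] ln_mult[of 4 3] ln_mult[of 2 7] ln_mult[of 2 12] ln_mult[of 4 7]
        ln_mult[of 24 7] by simp_all
    hence "Q' = - (7 / 12 * ln 2 + 3 / 14 * ln 3 + ln 7 / 24)"
      by (simp add: Q'_def weights_b_def field_simps)
    ultimately show ?thesis using ln_2_3_7_bounds by simp
  qed
  hence "n * ((18 * ln 3 - 24 * ln 2) * R - Q') \<ge> n * (677 / 1000)"
    by (intro mult_left_mono) auto
  ultimately show ?thesis by linarith
qed

text \<open>Split by \<open>t = 72 * n div m\<close>: \<open>t = 8\<close> is the interval,
  \<open>t \<ge> 4000\<close> means \<open>m \<le> 9 * n div 500\<close>, and all other terms are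
  nonpositive.\<close>

lemma sum_mangoldt_weight_upper:
  "(\<Sum>m=1..72*n. mangoldt m * of_int (weight (72 * n div m)))
     \<le> 2 * (\<Sum>m\<in>{8*n<..9*n}. mangoldt m) + 18 * psi (9 * n div 500)"
proof -
  have "(\<Sum>m=1..72*n. mangoldt m * real_of_int (weight (72 * n div m))) \<le>
     (\<Sum>m=1..72*n. 2 * (if m \<in> {8*n<..9*n} then mangoldt m else 0) +
                    18 * (if m \<le> 9 * n div 500 then mangoldt m else 0))"
  proof (intro sum_mono)
    fix m assume m: "m \<in> {1..72*n}"
    define t where "t = 72 * n div m"
    have nn: "(mangoldt m :: real) \<ge> 0" by (rule mangoldt_nonneg)
    consider "t \<ge> 4000" | "t = 8" | "t < 4000" "t \<noteq> 8" by linarith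
    thus "mangoldt m * real_of_int (weight (72 * n div m)) \<le>
          2 * (if m \<in> {8*n<..9*n} then mangoldt m else 0) +
          18 * (if m \<le> 9 * n div 500 then mangoldt m else 0)"
    proof cases
      case 1
      have "4000 * m \<le> t * m" using 1 by simp
      also have "\<dots> \<le> 72 * n" by (simp add: t_def)
      finally have "m \<le> 9 * n div 500" by simp
      moreover have "mangoldt m * real_of_int (weight t) \<le> mangoldt m * 18"
        using weight_le_18[of t] nn by (intro mult_left_mono) auto
      ultimately show ?thesis using nn by (simp add: t_def)
    next
      case 2
      have "8 * m \<le> 72 * n" "72 * n < 9 * m"
        using m 2 div_times_less_eq_dividend[of "72 * n" m] dividend_less_div_times[of m "72 * n"]
        by (simp_all add: t_def)
      hence "m \<in> {8*n<..9*n}" by simp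
      moreover have "weight 8 = 2"
        by (simp add: weight_def floor_comb_def weights_a_def weights_b_def)
      ultimately show ?thesis using nn 2 by (simp add: t_def)
    next
      case 3
      have "mangoldt m * real_of_int (weight t) \<le> 0"
        using weight_le_0[OF 3] nn by (intro mult_nonneg_nonpos) auto
      thus ?thesis using nn by (simp add: t_def)
    qed
  qed
  also have "\<dots> = 2 * (\<Sum>m\<in>{m\<in>{1..72*n}. m \<in> {8*n<..9*n}}. mangoldt m) +
                  18 * (\<Sum>m\<in>{m\<in>{1..72*n}. m \<le> 9 * n div 500}. mangoldt m)"
    by (simp add: sum.distrib flip: sum_distrib_left sum.inter_filter)
  also have "{m\<in>{1..72*n}. m \<in> {8*n<..9*n}} = {8*n<..9*n}" by auto
  also have "{m\<in>{1..72*n}. m \<le> 9 * n div 500} = {1..9 * n div 500}" by auto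
  finally show ?thesis by (simp add: psi_def)
qed

section \<open>Proper prime powers in the interval\<close>

text \<open>Only powers with exponent at least 2 remain, so their bases are at most
  \<open>sqrt (9 * n)\<close>. Each base occurs once: two powers of one prime differ by a factor of
  at least 2, too much for the interval.\<close>

lemma sum_mangoldt_no_primes:
  assumes "\<And>p. p \<in> {8*n<..9*n} \<Longrightarrow> \<not> prime p" "n > 0"
  shows "(\<Sum>m\<in>{8*n<..9*n}. mangoldt m) \<le> sqrt (9 * n) * ln (sqrt (9 * n))"
proof -
  define P where "P = {m \<in> {8*n<..9*n}. primepow m}"
  have base: "prime (aprimedivisor m) \<and> aprimedivisor m ^ 2 \<le> 9 * n \<and>
    (\<exists>k. m = aprimedivisor m ^ k)" if "m \<in> P" for m
  proof -
    from that obtain p k where pk: "prime p" "k > 0" "m = p ^ k"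
      by (auto simp: P_def primepow_def)
    have "k \<noteq> 1" using pk that assms(1)[of m] by (auto simp: P_def)
    hence "p ^ 2 \<le> p ^ k" using pk by (intro power_increasing) (auto simp: prime_gt_0_nat Suc_leI)
    thus ?thesis using pk that by (auto simp: P_def aprimedivisor_prime_power)
  qed
  have inj: "inj_on aprimedivisor P"
  proof (rule inj_onI)
    have False if mm': "m < m'" "m \<in> P" "m' \<in> P" "aprimedivisor m = aprimedivisor m'" for m m'
    proof -
      define p where "p = aprimedivisor m"
      obtain k k' where "m = aprimedivisor m ^ k" "m' = aprimedivisor m' ^ k'"
        using base[OF mm'(2)] base[OF mm'(3)] by blast
      hence k: "m = p ^ k" "m' = p ^ k'" using mm'(4) by (simp_all add: p_def)
      have p: "p > 1" using base[OF mm'(2)] by (simp add: p_def prime_gt_Suc_0_nat)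
      have "k < k'" using mm'(1) p unfolding k by simp
      hence "p ^ Suc k \<le> p ^ k'" using p by (intro power_increasing) auto
      moreover have "2 * p ^ k \<le> p * p ^ k" using p by (intro mult_right_mono) auto
      ultimately have "2 * m \<le> m'" unfolding k power_Suc by linarith
      thus False using mm' assms(2) by (auto simp: P_def)
    qed
    thus "x = y" if "x \<in> P" "y \<in> P" "aprimedivisor x = aprimedivisor y" for x y
      using that by (metis linorder_neqE_nat)
  qed
  define S where "S = nat \<lfloor>sqrt (9 * n)\<rfloor>"
  have le_sqrt: "real p \<le> sqrt (9 * n)" if "p \<in> aprimedivisor ` P" for p
  proof -
    have "p ^ 2 \<le> 9 * n" using base that by auto
    hence "real p ^ 2 \<le> real (9 * n)" by (metis of_nat_le_iff of_nat_power)
    thus ?thesis by (intro real_le_rsqrt) simp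
  qed
  have pos: "p \<ge> 1" if "p \<in> aprimedivisor ` P" for p
    using base that by (auto simp: prime_ge_Suc_0_nat)
  have "aprimedivisor ` P \<subseteq> {1..S}"
  proof
    fix p assume p: "p \<in> aprimedivisor ` P"
    have "int p \<le> \<lfloor>sqrt (9 * n)\<rfloor>" using le_sqrt[OF p] by (simp add: le_floor_iff)
    thus "p \<in> {1..S}" using pos[OF p] by (simp add: S_def le_nat_iff)
  qed
  hence "card (aprimedivisor ` P) \<le> S" using card_mono[of "{1..S}"] by simp
  also have "real S \<le> sqrt (9 * n)" by (simp add: S_def)
  finally have card: "real (card (aprimedivisor ` P)) \<le> sqrt (9 * n)" by simp
  have "(\<Sum>m\<in>{8*n<..9*n}. mangoldt m :: real) = (\<Sum>m\<in>P. ln (aprimedivisor m))"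
    unfolding P_def by (subst sum.inter_filter) (auto intro!: sum.cong simp: mangoldt_def)
  also have "\<dots> = (\<Sum>p\<in>aprimedivisor ` P. ln (real p))"
    by (simp add: sum.reindex[OF inj])
  also have "\<dots> \<le> (\<Sum>p\<in>aprimedivisor ` P. ln (sqrt (9 * n)))"
  proof (rule sum_mono)
    fix p assume p: "p \<in> aprimedivisor ` P"
    show "ln (real p) \<le> ln (sqrt (9 * n))"
      using le_sqrt[OF p] pos[OF p] by (intro ln_mono) auto
  qed
  also have "\<dots> \<le> sqrt (9 * n) * ln (sqrt (9 * n))"
    using card assms(2) by (simp add: mult_right_mono)
  finally show ?thesis .
qed

section \<open>Contradiction for large arguments and conclusion\<close>

text \<open>This is the tangent at 1024, a power of 2 near the threshold 948 for \<open>r\<close>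
  used below, with \<open>10 * ln 2 - 1\<close> rounded up to 6.\<close>

lemma ln_le_tangent: "ln r \<le> r / 1024 + 6" if "r > 0" for r :: real
proof -
  have "ln (r / 1024) \<le> r / 1024 - 1" using that by (intro ln_le_minus_one) simp
  moreover have "ln (1024::real) = 10 * ln 2" using ln_realpow[of 2 10] by simp
  ultimately show ?thesis using ln_2_3_7_bounds(1) that by (simp add: ln_div)
qed

lemma prime_between_8n_9n_large:
  fixes n :: nat
  assumes "n \<ge> 100000"
  shows "\<exists>p. prime p \<and> 8 * n < p \<and> p \<le> 9 * n"
proof (rule ccontr)
  assume "\<not> ?thesis"
  hence no: "\<not> prime p" if "p \<in> {8*n<..9*n}" for p using that by auto
  define r where "r = sqrt (9 * n)"
  have r2: "r ^ 2 = 9 * real n" by (simp add: r_def)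
  have r: "r \<ge> 948"
    unfolding r_def using assms by (intro real_le_rsqrt) simp
  have "677 / 1000 * n - 112 * ln (9 * n) \<le> 2 * (r * ln r) + 18 * psi (9 * n div 500)"
    using sum_mangoldt_weight_lower[of n] sum_mangoldt_weight_upper[of n] sum_mangoldt_no_primes[OF no]
      assms unfolding r_def by fastforce
  also have "psi (9 * n div 500) \<le> 9 * n / 500 * (2 * 0.69315)"
  proof -
    have "ln (4::real) = 2 * ln 2" using ln_realpow[of 2 2] by simp
    hence "psi (9 * n div 500) \<le> real (9 * n div 500) * (2 * ln 2)"
      using psi_le[of "9 * n div 500"] by simp
    also have "\<dots> \<le> 9 * n / 500 * (2 * 0.69315)"
      using ln_2_3_7_bounds(1) of_nat_div_le_of_nat[of "9 * n" 500, where ?'a = real]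
      by (intro mult_mono) auto
    finally show ?thesis .
  qed
  also have "ln (9 * n) = 2 * ln r"
    using r r2 ln_realpow[of r 2] by simp
  \<comment> \<open>The \<open>psi\<close> term takes about \<open>0.4492 * n\<close> from
    \<open>0.677 * n\<close>, leaving more than \<open>0.227 * n\<close>.\<close>
  finally have "227 / 1000 * n \<le> (2 * r + 224) * ln r" by (simp add: algebra_simps)
  also have "\<dots> \<le> (2 * r + 224) * (r / 1024 + 6)"
    using ln_le_tangent[of r] r by (intro mult_left_mono) auto
  also have "\<dots> = r ^ 2 / 512 + 391 / 32 * r + 1344"
    by (simp add: field_simps power2_eq_square)
  finally have "227 / 9000 * r ^ 2 \<le> r ^ 2 / 512 + 391 / 32 * r + 1344"
    using r2 by simp
  moreover have "r ^ 2 \<ge> 948 * r" using r by (simp add: power2_eq_square)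
  ultimately show False using r by linarith
qed

theorem theorem2p2p10:
  fixes n :: nat
  assumes "n > 4"
  shows "\<exists>p::nat. prime p \<and> 8 * n < p \<and> p < 9 * n"
proof (cases "n < 100000")
  case True
  thus ?thesis using prime_chain_imp[OF prime_chain_100000] assms by simp
next
  case False
  then obtain p where p: "prime p" "8 * n < p" "p \<le> 9 * n"
    using prime_between_8n_9n_large[of n] by auto
  \<comment> \<open>The estimates treat the interval closed at \<open>9 * n\<close>; compositeness
    of this endpoint makes the bound strict.\<close>
  have "\<not> prime (9 * n)"
    using prime_product[of 9 n] assms by auto
  with p show ?thesis by (metis le_neq_implies_less)
qed

end
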